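(* Let $(A_n)_{n\ge1}$ be a sequence in $\mathbb{R}^{d_1\times d_2\times d_3}$ with $A_n\to A$, where $\operatorname{rank}_\otimes(A)\ge r+1$ and $\operatorname{rank}_\otimes(A_n)\le r$ for all $n$. If we write $$A_n=\lambda_{1,n}\,\mathbf{u}_{1,n}\otimes\mathbf{v}_{1,n}\otimes\mathbf{w}_{1,n}+\dots+\lambda_{r,n}\,\mathbf{u}_{r,n}\otimes\mathbf{v}_{r,n}\otimes\mathbf{w}_{r,n},$$ where $\lambda_{i,n}\in\mathbb{R}$ and the vectors $\mathbf{u}_{i,n}\in\mathbb{R}^{d_1}$, $\mathbf{v}_{i,n}\in\mathbb{R}^{d_2}$, $\mathbf{w}_{i,n}\in\mathbb{R}^{d_3}$ are unit vectors, then $\max_i\{|\lambda_{i,n}|\}\to\infty$ as $n\to\infty$. Moreover, at least two of the coefficient sequences $\{\lambda_{i,n}\mid n=1,2,\dots\}$, $i=1,\dots,r$, are unbounded.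
   Context: $\mathbb{R}^{d_1\times d_2\times d_3}\cong\mathbb{R}^{d_1}\otimes\mathbb{R}^{d_2}\otimes\mathbb{R}^{d_3}$ is the space of real 3-way arrays; $\mathbf{x}\otimes\mathbf{y}\otimes\mathbf{z}$ is the array with entries $x_iy_jz_k$ (a decomposable tensor). The outer-product rank $\operatorname{rank}_{\otimes}(A)$ is the least $r\ge 0$ such that $A$ is a sum of $r$ decomposable tensors. Convergence is in the (unique) norm topology; unit vectors are with respect to the Euclidean norm. *)

theory Defs
  imports "HOL-Analysis.Analysis"
begin

text \<open>The type \<open>real ^ 'd3 ^ 'd2 ^ 'd1\<close> is the space of \<open>d1 \<times> d2 \<times> d3\<close> arrays, with entries
  \<open>A $ i $ j $ k\<close>; its library topology is the norm topology.\<close>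

definition tensor3 ::
  "real ^ 'd1 \<Rightarrow> real ^ 'd2 \<Rightarrow> real ^ 'd3 \<Rightarrow> real ^ 'd3 ^ 'd2 ^ 'd1" where
  "tensor3 x y z = (\<chi> i j k. x $ i * y $ j * z $ k)"

definition sum_of_decomposables :: "nat \<Rightarrow> real ^ 'd3 ^ 'd2 ^ 'd1 \<Rightarrow> bool" where
  "sum_of_decomposables r A \<longleftrightarrow>
     (\<exists>x y z. A = (\<Sum>i=1..r. tensor3 (x i) (y i) (z i)))"

definition tensor_rank :: "real ^ 'd3 ^ 'd2 ^ 'd1 \<Rightarrow> nat" where
  "tensor_rank A = (LEAST r. sum_of_decomposables r A)"

text \<open>The minimum is attained, so \<open>LEAST\<close> is never unspecified.\<close>

lemma ex_sum_of_decomposables: "\<exists>r. sum_of_decomposables r A"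
  for A :: "real ^ 'd3 ^ 'd2 ^ 'd1"
proof -
  obtain h :: "nat \<Rightarrow> 'd1 \<times> 'd2 \<times> 'd3"
    where h: "bij_betw h {1..card (UNIV :: ('d1 \<times> 'd2 \<times> 'd3) set)} UNIV"
    using ex_bij_betw_nat_finite_1[of "UNIV :: ('d1 \<times> 'd2 \<times> 'd3) set"] by auto
  define x where "x p = (axis (fst p) 1 :: real ^ 'd1)" for p :: "'d1 \<times> 'd2 \<times> 'd3"
  define y where "y p = (axis (fst (snd p)) 1 :: real ^ 'd2)" for p :: "'d1 \<times> 'd2 \<times> 'd3"
  define z where "z p = (axis (snd (snd p)) (A $ fst p $ fst (snd p) $ snd (snd p)) :: real ^ 'd3)"
    for p :: "'d1 \<times> 'd2 \<times> 'd3"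
  have "(\<Sum>p\<in>UNIV. tensor3 (x p) (y p) (z p)) $ i $ j $ k = A $ i $ j $ k" for i j k
  proof -
    have "tensor3 (x p) (y p) (z p) $ i $ j $ k = (if p = (i, j, k) then A $ i $ j $ k else 0)"
      for p
      by (cases p) (simp add: tensor3_def x_def y_def z_def axis_def)
    then show ?thesis
      by (simp add: sum_component)
  qed
  then have "A = (\<Sum>p\<in>UNIV. tensor3 (x p) (y p) (z p))"
    by (simp add: vec_eq_iff)
  also have "\<dots> = (\<Sum>i=1..card (UNIV :: ('d1 \<times> 'd2 \<times> 'd3) set).
      tensor3 ((x \<circ> h) i) ((y \<circ> h) i) ((z \<circ> h) i))"
    using sum.reindex_bij_betw[OF h, of "\<lambda>p. tensor3 (x p) (y p) (z p)"] by (simp only: o_apply)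
  finally show ?thesis
    unfolding sum_of_decomposables_def by (intro exI)
qed

lemma tensor_rank_attained: "sum_of_decomposables (tensor_rank A) A"
  unfolding tensor_rank_def by (rule LeastI_ex) (rule ex_sum_of_decomposables)

end

(* The tensors that are sums of r multiples of unit decomposable tensors with coefficients in
   [-K, K] form a compact set, all of whose members have rank at most r. Hence A_n leaves this set
   eventually, for every K, and the largest coefficient diverges. If all coefficient sequences but
   one were bounded, the remaining term would be a difference of bounded terms; as a unit
   decomposable tensor has norm 1, its coefficients would be bounded as well. *)
theory Submission
  imports Defs
begin

text \<open>The entries \<open>m\<close> range over any normed space, so that the lemma applies at
  each level of the nested array type.\<close>

lemma norm_vec_scaleR_const:
  fixes a :: "real ^ 'n" and m :: "'b :: real_normed_vector"
  shows "norm (\<chi> i. a $ i *\<^sub>R m) = norm a * norm m"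
  by (simp add: norm_vec_def L2_set_left_distrib)

lemma norm_tensor3: "norm (tensor3 x y z) = norm x * norm y * norm z"
proof -
  have "tensor3 x y z = (\<chi> i. x $ i *\<^sub>R (\<chi> j. y $ j *\<^sub>R z))"
    by (simp add: tensor3_def vec_eq_iff mult.assoc)
  then show ?thesis
    by (simp only: norm_vec_scaleR_const mult.assoc)
qed

lemma tensor3_scaleR_left: "tensor3 (c *\<^sub>R x) y z = c *\<^sub>R tensor3 x y z"
  by (simp add: tensor3_def vec_eq_iff mult.assoc)

text \<open>Each coefficient is absorbed into the first factor of its term.\<close>

lemma tensor_rank_sum_scaled_le:
  "tensor_rank (\<Sum>i=1..r. c i *\<^sub>R tensor3 (x i) (y i) (z i)) \<le> r"
  unfolding tensor_rank_def
proof (rule Least_le)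
  show "sum_of_decomposables r (\<Sum>i=1..r. c i *\<^sub>R tensor3 (x i) (y i) (z i))"
    unfolding sum_of_decomposables_def tensor3_scaleR_left [symmetric]
    by (rule exI [of _ "\<lambda>i. c i *\<^sub>R x i"]) blast
qed

text \<open>By induction: adding an index to \<open>I\<close> forms the Minkowski sum with one more
  compact set.\<close>

lemma compact_sum_choices:
  fixes T :: "'i \<Rightarrow> 'a :: real_normed_vector set"
  assumes "finite I" and "\<And>i. i \<in> I \<Longrightarrow> compact (T i)"
  shows "compact {\<Sum>i\<in>I. t i | t. \<forall>i\<in>I. t i \<in> T i}"
  using assms
proof (induction I rule: finite_induct)
  case empty
  then show ?case by simp
next
  case (insert a I)
  let ?S = "{\<Sum>i\<in>I. t i | t. \<forall>i\<in>I. t i \<in> T i}"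
  have "{\<Sum>i\<in>insert a I. t i | t. \<forall>i\<in>insert a I. t i \<in> T i} = {x + y | x y. x \<in> T a \<and> y \<in> ?S}"
    (is "?L = ?R")
  proof
    show "?L \<subseteq> ?R"
      using insert.hyps by auto
    show "?R \<subseteq> ?L"
    proof
      fix s assume "s \<in> ?R"
      then obtain x t where x: "x \<in> T a" and t: "\<forall>i\<in>I. t i \<in> T i" and s: "s = x + sum t I"
        by blast
      \<comment> \<open>As \<open>a\<close> lies outside \<open>I\<close>, the value of
        \<open>t\<close> at \<open>a\<close> can be overwritten freely.\<close>
      have "sum (t(a := x)) I = sum t I"
        using insert.hyps by (intro sum.cong) auto
      then have "sum (t(a := x)) (insert a I) = s"
        using insert.hyps s by simp
      moreover have "\<forall>i\<in>insert a I. (t(a := x)) i \<in> T i"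
        using x t by simp
      ultimately show "s \<in> ?L"
        by blast
    qed
  qed
  moreover have "compact ?R"
    using insert by (intro compact_sums) simp_all
  ultimately show ?case
    by (simp only:)
qed

text \<open>This is the continuous image of a product of an interval and three unit spheres. For
  negative \<open>K\<close> the interval, and so the set, is empty.\<close>

lemma compact_scaled_unit_tensors:
  "compact {c *\<^sub>R tensor3 x y z | c x y z. \<bar>c\<bar> \<le> K \<and> norm x = 1 \<and> norm y = 1 \<and> norm z = 1}"
    (is "compact ?T")
proof -
  let ?D = "cball 0 K \<times> sphere 0 1 \<times> sphere 0 1 \<times> sphere 0 1"
  let ?f = "\<lambda>(c, x, y, z). c *\<^sub>R tensor3 x y z"
  have "?T = ?f ` ?D"
  proof
    show "?T \<subseteq> ?f ` ?D"
      by (auto intro!: rev_image_eqI [of "(c, x, y, z)" for c x y z])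
    show "?f ` ?D \<subseteq> ?T"
      by auto blast
  qed
  moreover have "continuous_on ?D ?f"
    unfolding tensor3_def case_prod_unfold by (intro continuous_intros)
  ultimately show ?thesis
    by (simp only:) (intro compact_continuous_image compact_Times compact_cball compact_sphere)
qed

theorem proposition4p8:
  fixes A :: "nat \<Rightarrow> real ^ 'd3 ^ 'd2 ^ 'd1"
    and A\<^sub>0 :: "real ^ 'd3 ^ 'd2 ^ 'd1"
    and r :: nat
    and lam :: "nat \<Rightarrow> nat \<Rightarrow> real"
    and u :: "nat \<Rightarrow> nat \<Rightarrow> real ^ 'd1"
    and v :: "nat \<Rightarrow> nat \<Rightarrow> real ^ 'd2"
    and w :: "nat \<Rightarrow> nat \<Rightarrow> real ^ 'd3"
  assumes "A \<longlonglongrightarrow> A\<^sub>0"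
    and "tensor_rank A\<^sub>0 \<ge> r + 1"
    and "\<And>n. n \<ge> 1 \<Longrightarrow> tensor_rank (A n) \<le> r"
    and "\<And>n. n \<ge> 1 \<Longrightarrow> A n = (\<Sum>i=1..r. lam i n *\<^sub>R tensor3 (u i n) (v i n) (w i n))"
    and "\<And>i n. i \<in> {1..r} \<Longrightarrow> n \<ge> 1 \<Longrightarrow> norm (u i n) = 1"
    and "\<And>i n. i \<in> {1..r} \<Longrightarrow> n \<ge> 1 \<Longrightarrow> norm (v i n) = 1"
    and "\<And>i n. i \<in> {1..r} \<Longrightarrow> n \<ge> 1 \<Longrightarrow> norm (w i n) = 1"
  shows "filterlim (\<lambda>n. MAX i\<in>{1..r}. \<bar>lam i n\<bar>) at_top sequentially
    \<and> card {i \<in> {1..r}. \<not> bounded (lam i ` {1..})} \<ge> 2"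
proof -
  \<comment> \<open>For \<open>r = 0\<close> no index exists, so this claim refutes the hypotheses;
    it also ensures that the maximum below is over a nonempty set.\<close>
  have large: "\<forall>\<^sub>F n in sequentially. \<exists>i\<in>{1..r}. K < \<bar>lam i n\<bar>" for K
  proof -
    let ?T = "{c *\<^sub>R tensor3 x y z | c (x :: real ^ 'd1) (y :: real ^ 'd2) (z :: real ^ 'd3).
      \<bar>c\<bar> \<le> K \<and> norm x = 1 \<and> norm y = 1 \<and> norm z = 1}"
    let ?S = "{\<Sum>i=1..r. t i | t. \<forall>i\<in>{1..r}. t i \<in> ?T}"
    have "closed ?S"
      by (intro compact_imp_closed compact_sum_choices compact_scaled_unit_tensors) simp
    moreover have "A\<^sub>0 \<notin> ?S"
    proof
      assume "A\<^sub>0 \<in> ?S"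
      then obtain t where t: "\<forall>i\<in>{1..r}. t i \<in> ?T" and A0: "A\<^sub>0 = (\<Sum>i=1..r. t i)"
        by blast
      have "\<forall>i\<in>{1..r}. \<exists>c x y z. t i = c *\<^sub>R tensor3 x y z"
        using t by blast
      then obtain c x y z where "\<forall>i\<in>{1..r}. t i = c i *\<^sub>R tensor3 (x i) (y i) (z i)"
        by metis
      with A0 have "tensor_rank A\<^sub>0 \<le> r"
        using tensor_rank_sum_scaled_le [of c x y z r] by simp
      with assms(2) show False
        by simp
    qed
    \<comment> \<open>The complement of \<open>?S\<close> is an open neighbourhood of the
      limit.\<close>
    ultimately have "\<forall>\<^sub>F n in sequentially. A n \<in> - ?S"
      by (intro topological_tendstoD [OF assms(1)]) (auto simp: open_Compl)
    with eventually_ge_at_top [of 1] show ?thesis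
    proof eventually_elim
      case (elim n)
      show ?case
      proof (rule ccontr)
        assume "\<not> ?thesis"
        then have "\<forall>i\<in>{1..r}. \<bar>lam i n\<bar> \<le> K"
          by force
        with assms(5-7) elim(1)
        have "\<forall>i\<in>{1..r}. lam i n *\<^sub>R tensor3 (u i n) (v i n) (w i n) \<in> ?T"
          by blast
        with assms(4) [OF elim(1)] have "A n \<in> ?S"
          by blast
        with elim(2) show False
          by (rule ComplD [THEN notE])
      qed
    qed
  qed
  have "filterlim (\<lambda>n. MAX i\<in>{1..r}. \<bar>lam i n\<bar>) at_top sequentially"
    unfolding filterlim_at_top
  proof
    fix K
    show "\<forall>\<^sub>F n in sequentially. K \<le> (MAX i\<in>{1..r}. \<bar>lam i n\<bar>)"
      using large [of K]
    proof eventually_elim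
      case (elim n)
      then obtain i where i: "i \<in> {1..r}" "K < \<bar>lam i n\<bar>"
        by blast
      then have "\<bar>lam i n\<bar> \<le> (MAX i\<in>{1..r}. \<bar>lam i n\<bar>)"
        by (intro Max_ge) auto
      with i show ?case
        by linarith
    qed
  qed
  moreover have "card {i \<in> {1..r}. \<not> bounded (lam i ` {1..})} \<ge> 2" (is "card ?U \<ge> 2")
  proof (rule ccontr)
    assume "\<not> card ?U \<ge> 2"
    then have "card ?U \<le> Suc 0"
      by simp
    then have "\<forall>i\<in>?U. \<forall>j\<in>?U. i = j"
      by (subst (asm) card_le_Suc0_iff_eq) auto
    \<comment> \<open>If \<open>?U\<close> is empty, \<open>k\<close> is arbitrary and may lie
      outside \<open>{1..r}\<close>; hence the premise on \<open>k\<close> in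
      \<open>k_le\<close>.\<close>
    then obtain k where k: "?U \<subseteq> {k}"
      by blast
    have "\<exists>b. \<forall>n\<ge>1. \<bar>lam i n\<bar> \<le> b" if "i \<in> {1..r} - {k}" for i
      using that k by (force simp: bounded_iff)
    then obtain b where b: "\<And>i n. i \<in> {1..r} - {k} \<Longrightarrow> n \<ge> 1 \<Longrightarrow> \<bar>lam i n\<bar> \<le> b i"
      by metis
    obtain M where M: "\<And>n. norm (A n) \<le> M"
      using convergent_imp_bounded [OF assms(1)] by (auto simp: bounded_iff)
    \<comment> \<open>The triangle inequality gives this bound once the term of index
      \<open>k\<close> is written as \<open>A n\<close> minus the other terms.\<close>
    define B where "B = M + (\<Sum>i\<in>{1..r} - {k}. b i)"
    have norm_term: "norm (lam i n *\<^sub>R tensor3 (u i n) (v i n) (w i n)) = \<bar>lam i n\<bar>"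
      if "i \<in> {1..r}" "n \<ge> 1" for i n
      using that assms(5-7) by (simp add: norm_tensor3)
    have k_le: "\<bar>lam k n\<bar> \<le> B" if "k \<in> {1..r}" "n \<ge> 1" for n
    proof -
      let ?t = "\<lambda>i. lam i n *\<^sub>R tensor3 (u i n) (v i n) (w i n)"
      have "?t k = A n - sum ?t ({1..r} - {k})"
        using that assms(4) [of n] by (simp add: sum_diff1)
      then have "\<bar>lam k n\<bar> = norm (A n - sum ?t ({1..r} - {k}))"
        using norm_term that by metis
      also have "\<dots> \<le> norm (A n) + norm (sum ?t ({1..r} - {k}))"
        by (rule norm_triangle_ineq4)
      also have "\<dots> \<le> B"
        unfolding B_def
      proof (intro add_mono M sum_norm_le)
        show "norm (?t i) \<le> b i" if "i \<in> {1..r} - {k}" for i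
          using that \<open>n \<ge> 1\<close> norm_term [of i n] b [of i n] by (simp only: DiffD1)
      qed
      finally show ?thesis .
    qed
    \<comment> \<open>A common bound for all coefficients, to contradict \<open>large\<close>. The
      value \<open>b k\<close> is unconstrained, but can only enlarge the maximum; index
      \<open>k\<close> is covered by \<open>B\<close>.\<close>
    define K where "K = Max (insert B (b ` {1..r}))"
    have "\<bar>lam i n\<bar> \<le> K" if "i \<in> {1..r}" "n \<ge> 1" for i n
    proof (cases "i = k")
      case True
      have "B \<le> K"
        unfolding K_def by (intro Max_ge) auto
      with True k_le that show ?thesis
        by force
    next
      case False
      have "b i \<le> K"
        unfolding K_def using that by (intro Max_ge) auto
      with False b [of i n] that show ?thesis
        by simp
    qed
    \<comment> \<open>The index must be at least 1, since nothing is assumed about the coefficients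
      at \<open>n = 0\<close>.\<close>
    moreover obtain n i where "n \<ge> 1" "i \<in> {1..r}" "K < \<bar>lam i n\<bar>"
      using eventually_happens [OF eventually_conj [OF eventually_ge_at_top [of 1] large [of K]]]
      by auto
    ultimately show False
      by force
  qed
  ultimately show ?thesis
    by blast
qed

end
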